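(* Let $(M,g)$ be a Riemannian or Lorentzian manifold, $E$ a unitary vector field on $M$ (timelike in the Lorentzian case), $\varepsilon=g(E,E)$, $\omega=g(E,\cdot)$, $t\in\mathbb{R}\setminus\{-\varepsilon\}$, and let $g_t=g+t\,\omega\otimes\omega$ be the canonical variation of $g$ along $E$. Let $\nabla$, $\nabla^t$ be the Levi-Civita connections of $g$, $g_t$ and $D^t=\nabla^t-\nabla$. Then for all vector fields $U,V,W$ on $M$, $$g_t(D^t(U,V),W)=\frac{t}{2}\Big(\omega(W)\,(L_E g)(U,V)+\omega(U)\,d\omega(V,W)+\omega(V)\,d\omega(U,W)\Big).$$
   Context: Lorentzian metrics have signature $(-,+,\dots,+)$. A vector field $E$ is unitary if $g(E,E)=\pm1$; thus $\varepsilon=1$ in the Riemannian case and $\varepsilon=-1$ in the Lorentzian case (where $E$ is timelike). $L_Eg$ is the Lie derivative. The exterior differential is normalized by $d\omega(U,V)=(\nabla_U\omega)(V)-(\nabla_V\omega)(U)$. *)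

theory Defs
  imports "HOL-Analysis.Analysis"
begin

section \<open>Smooth maps between normed spaces\<close>

text \<open>Meant for open \<open>S\<close>: all iterated directional derivatives up to order \<open>k\<close> exist as
  Frechet derivatives and are continuous on \<open>S\<close>, that is, \<open>f\<close> is of class \<open>C\<^sup>k\<close> on \<open>S\<close>.\<close>

primrec Ck_on :: "nat \<Rightarrow> 'b::real_normed_vector set \<Rightarrow> ('b \<Rightarrow> 'c::real_normed_vector) \<Rightarrow> bool" where
  "Ck_on 0 S f \<longleftrightarrow> continuous_on S f"
| "Ck_on (Suc k) S f \<longleftrightarrow>
     (\<forall>x\<in>S. f differentiable (at x)) \<and> (\<forall>v. Ck_on k S (\<lambda>x. frechet_derivative f (at x) v))"

definition smooth_on :: "'b::real_normed_vector set \<Rightarrow> ('b \<Rightarrow> 'c::real_normed_vector) \<Rightarrow> bool" where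
  "smooth_on S f \<longleftrightarrow> (\<forall>k. Ck_on k S f)"


section \<open>Smooth manifolds\<close>

text \<open>The underlying set is \<open>topspace (top_of M)\<close>; a chart is a pair of a domain and a map into the
  model space \<open>'b\<close>, so that the dimension is \<open>DIM('b)\<close>.  The atlas need not be maximal.  The
  values of charts, functions and tensors outside the underlying set are irrelevant.\<close>

record ('a, 'b) manifold =
  top_of :: "'a topology"
  charts :: "('a set \<times> ('a \<Rightarrow> 'b)) set"

abbreviation points :: "('a, 'b) manifold \<Rightarrow> 'a set" where
  "points M \<equiv> topspace (top_of M)"

definition smooth_manifold :: "('a, 'b::euclidean_space) manifold \<Rightarrow> bool" where
  "smooth_manifold M \<longleftrightarrow>
     Hausdorff_space (top_of M) \<and> second_countable (top_of M) \<and>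
     (\<forall>(U, \<phi>)\<in>charts M.
        openin (top_of M) U \<and> open (\<phi> ` U) \<and>
        homeomorphic_map (subtopology (top_of M) U) (top_of_set (\<phi> ` U)) \<phi>) \<and>
     points M = (\<Union>(U, \<phi>)\<in>charts M. U) \<and>
     (\<forall>(U, \<phi>)\<in>charts M. \<forall>(V, \<psi>)\<in>charts M.
        smooth_on (\<phi> ` (U \<inter> V)) (\<psi> \<circ> inv_into U \<phi>))"

definition smooth_fun :: "('a, 'b::euclidean_space) manifold \<Rightarrow> ('a \<Rightarrow> real) \<Rightarrow> bool" where
  "smooth_fun M f \<longleftrightarrow> (\<forall>(U, \<phi>)\<in>charts M. smooth_on (\<phi> ` U) (f \<circ> inv_into U \<phi>))"


section \<open>Tangent vectors and vector fields\<close>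

text \<open>Tangent vectors at \<open>p\<close> are the derivations at \<open>p\<close> of the algebra of smooth functions, extended
  by \<open>0\<close> to non-smooth functions so that equality of tangent vectors is equality in HOL.  The
  Leibniz rule implies that the value depends only on the restriction of the function to
  the manifold.\<close>

type_synonym 'a tangent = "('a \<Rightarrow> real) \<Rightarrow> real"

definition tangent_space :: "('a, 'b::euclidean_space) manifold \<Rightarrow> 'a \<Rightarrow> 'a tangent set" where
  "tangent_space M p = {v.
     (\<forall>f. \<not> smooth_fun M f \<longrightarrow> v f = 0) \<and>
     (\<forall>f h a b. smooth_fun M f \<longrightarrow> smooth_fun M h \<longrightarrow>
        v (\<lambda>q. a * f q + b * h q) = a * v f + b * v h) \<and>
     (\<forall>f h. smooth_fun M f \<longrightarrow> smooth_fun M h \<longrightarrow>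
        v (\<lambda>q. f q * h q) = f p * v h + h p * v f)}"

text \<open>Fields are \<open>0\<close> outside of the manifold, again to make equality of fields equality in HOL.\<close>

definition vector_field :: "('a, 'b::euclidean_space) manifold \<Rightarrow> ('a \<Rightarrow> 'a tangent) \<Rightarrow> bool" where
  "vector_field M X \<longleftrightarrow>
     (\<forall>p\<in>points M. X p \<in> tangent_space M p) \<and>
     (\<forall>p. p \<notin> points M \<longrightarrow> X p = (\<lambda>f. 0)) \<and>
     (\<forall>f. smooth_fun M f \<longrightarrow> smooth_fun M (\<lambda>p. X p f))"

definition lie_bracket :: "('a \<Rightarrow> 'a tangent) \<Rightarrow> ('a \<Rightarrow> 'a tangent) \<Rightarrow> 'a \<Rightarrow> 'a tangent" where
  "lie_bracket X Y = (\<lambda>p f. X p (\<lambda>q. Y q f) - Y p (\<lambda>q. X q f))"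


section \<open>Riemannian and Lorentzian metrics\<close>

type_synonym 'a one_form = "'a \<Rightarrow> 'a tangent \<Rightarrow> real"
type_synonym 'a two_tensor = "'a \<Rightarrow> 'a tangent \<Rightarrow> 'a tangent \<Rightarrow> real"

definition symmetric_tensor :: "('a, 'b::euclidean_space) manifold \<Rightarrow> 'a two_tensor \<Rightarrow> bool" where
  "symmetric_tensor M g \<longleftrightarrow>
     (\<forall>p\<in>points M. \<forall>u\<in>tangent_space M p. \<forall>v\<in>tangent_space M p. g p u v = g p v u) \<and>
     (\<forall>p\<in>points M. \<forall>u\<in>tangent_space M p. \<forall>v\<in>tangent_space M p. \<forall>w\<in>tangent_space M p.
        \<forall>a b. g p (\<lambda>f. a * u f + b * v f) w = a * g p u w + b * g p v w) \<and>
     (\<forall>X Y. vector_field M X \<longrightarrow> vector_field M Y \<longrightarrow> smooth_fun M (\<lambda>p. g p (X p) (Y p)))"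

definition riemannian_metric :: "('a, 'b::euclidean_space) manifold \<Rightarrow> 'a two_tensor \<Rightarrow> bool" where
  "riemannian_metric M g \<longleftrightarrow> symmetric_tensor M g \<and>
     (\<forall>p\<in>points M. \<forall>v\<in>tangent_space M p. v \<noteq> (\<lambda>f. 0) \<longrightarrow> g p v v > 0)"

text \<open>Signature \<open>(-,+,\<dots>,+)\<close>: every tangent space is spanned by some \<open>e 0, \<dots>, e (n - 1)\<close> in which the
  Gram matrix of the metric is \<open>diag (-1, 1, \<dots>, 1)\<close>, where \<open>n\<close> is the dimension.\<close>

definition lorentzian_metric :: "('a, 'b::euclidean_space) manifold \<Rightarrow> 'a two_tensor \<Rightarrow> bool" where
  "lorentzian_metric M g \<longleftrightarrow> symmetric_tensor M g \<and>
     (\<forall>p\<in>points M. \<exists>e :: nat \<Rightarrow> 'a tangent.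
        (\<forall>i<DIM('b). e i \<in> tangent_space M p) \<and>
        (\<forall>v\<in>tangent_space M p. \<exists>c :: nat \<Rightarrow> real. v = (\<lambda>f. \<Sum>i<DIM('b). c i * e i f)) \<and>
        (\<forall>i<DIM('b). \<forall>j<DIM('b).
           g p (e i) (e j) = (if i \<noteq> j then 0 else if i = 0 then - 1 else 1)))"

definition unitary_field ::
    "('a, 'b::euclidean_space) manifold \<Rightarrow> 'a two_tensor \<Rightarrow> ('a \<Rightarrow> 'a tangent) \<Rightarrow> bool" where
  "unitary_field M g E \<longleftrightarrow> vector_field M E \<and>
     (\<forall>p\<in>points M. g p (E p) (E p) = 1 \<or> g p (E p) (E p) = - 1)"

definition timelike_field ::
    "('a, 'b::euclidean_space) manifold \<Rightarrow> 'a two_tensor \<Rightarrow> ('a \<Rightarrow> 'a tangent) \<Rightarrow> bool" where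
  "timelike_field M g E \<longleftrightarrow> vector_field M E \<and> (\<forall>p\<in>points M. g p (E p) (E p) < 0)"

definition dual_form :: "'a two_tensor \<Rightarrow> ('a \<Rightarrow> 'a tangent) \<Rightarrow> 'a one_form" where
  "dual_form g E = (\<lambda>p v. g p (E p) v)"

definition canonical_variation ::
    "'a two_tensor \<Rightarrow> ('a \<Rightarrow> 'a tangent) \<Rightarrow> real \<Rightarrow> 'a two_tensor" where
  "canonical_variation g E t =
     (\<lambda>p v w. g p v w + t * (dual_form g E p v * dual_form g E p w))"


section \<open>Connections and derivatives of tensors\<close>

type_synonym 'a connection = "('a \<Rightarrow> 'a tangent) \<Rightarrow> ('a \<Rightarrow> 'a tangent) \<Rightarrow> 'a \<Rightarrow> 'a tangent"

text \<open>\<open>nab X Y\<close> is the covariant derivative of \<open>Y\<close> in direction \<open>X\<close>.\<close>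

definition affine_connection :: "('a, 'b::euclidean_space) manifold \<Rightarrow> 'a connection \<Rightarrow> bool" where
  "affine_connection M nab \<longleftrightarrow>
     (\<forall>X Y. vector_field M X \<longrightarrow> vector_field M Y \<longrightarrow> vector_field M (nab X Y)) \<and>
     (\<forall>X Y Z f h. vector_field M X \<longrightarrow> vector_field M Y \<longrightarrow> vector_field M Z \<longrightarrow>
        smooth_fun M f \<longrightarrow> smooth_fun M h \<longrightarrow>
        nab (\<lambda>p k. f p * X p k + h p * Y p k) Z
          = (\<lambda>p k. f p * nab X Z p k + h p * nab Y Z p k)) \<and>
     (\<forall>X Y Z. vector_field M X \<longrightarrow> vector_field M Y \<longrightarrow> vector_field M Z \<longrightarrow>
        nab X (\<lambda>p k. Y p k + Z p k) = (\<lambda>p k. nab X Y p k + nab X Z p k)) \<and>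
     (\<forall>X Y f. vector_field M X \<longrightarrow> vector_field M Y \<longrightarrow> smooth_fun M f \<longrightarrow>
        nab X (\<lambda>p k. f p * Y p k) = (\<lambda>p k. X p f * Y p k + f p * nab X Y p k))"

definition torsion_free :: "('a, 'b::euclidean_space) manifold \<Rightarrow> 'a connection \<Rightarrow> bool" where
  "torsion_free M nab \<longleftrightarrow>
     (\<forall>X Y. vector_field M X \<longrightarrow> vector_field M Y \<longrightarrow>
        (\<lambda>p k. nab X Y p k - nab Y X p k) = lie_bracket X Y)"

definition metric_compatible ::
    "('a, 'b::euclidean_space) manifold \<Rightarrow> 'a two_tensor \<Rightarrow> 'a connection \<Rightarrow> bool" where
  "metric_compatible M g nab \<longleftrightarrow>
     (\<forall>X Y Z. vector_field M X \<longrightarrow> vector_field M Y \<longrightarrow> vector_field M Z \<longrightarrow>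
        (\<forall>p\<in>points M. X p (\<lambda>q. g q (Y q) (Z q))
           = g p (nab X Y p) (Z p) + g p (Y p) (nab X Z p)))"

definition levi_civita ::
    "('a, 'b::euclidean_space) manifold \<Rightarrow> 'a two_tensor \<Rightarrow> 'a connection \<Rightarrow> bool" where
  "levi_civita M g nab \<longleftrightarrow>
     affine_connection M nab \<and> torsion_free M nab \<and> metric_compatible M g nab"

definition connection_difference :: "'a connection \<Rightarrow> 'a connection \<Rightarrow> 'a connection" where
  "connection_difference nab' nab = (\<lambda>U V p k. nab' U V p k - nab U V p k)"

text \<open>The Lie derivative acts as a derivation that commutes with contractions, with
  \<open>L\<^sub>X f = X f\<close> on functions and \<open>L\<^sub>X Y = [X, Y]\<close> on vector fields.\<close>

definition lie_derivative ::
    "('a \<Rightarrow> 'a tangent) \<Rightarrow> 'a two_tensor \<Rightarrow> ('a \<Rightarrow> 'a tangent) \<Rightarrow> ('a \<Rightarrow> 'a tangent) \<Rightarrow> 'a \<Rightarrow> real" where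
  "lie_derivative X g U V = (\<lambda>p. X p (\<lambda>q. g q (U q) (V q))
     - g p (lie_bracket X U p) (V p) - g p (U p) (lie_bracket X V p))"

definition covariant_derivative_form ::
    "'a connection \<Rightarrow> ('a \<Rightarrow> 'a tangent) \<Rightarrow> 'a one_form \<Rightarrow> ('a \<Rightarrow> 'a tangent) \<Rightarrow> 'a \<Rightarrow> real" where
  "covariant_derivative_form nab U \<omega> V =
     (\<lambda>p. U p (\<lambda>q. \<omega> q (V q)) - \<omega> p (nab U V p))"

text \<open>The normalization without a factor \<open>1/2\<close>; \<open>nab\<close> is meant to be torsion free, and then it
  does not matter (see \<open>exterior_derivative_invariant\<close>).\<close>

definition exterior_derivative ::
    "'a connection \<Rightarrow> 'a one_form \<Rightarrow> ('a \<Rightarrow> 'a tangent) \<Rightarrow> ('a \<Rightarrow> 'a tangent) \<Rightarrow> 'a \<Rightarrow> real" where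
  "exterior_derivative nab \<omega> U V =
     (\<lambda>p. covariant_derivative_form nab U \<omega> V p - covariant_derivative_form nab V \<omega> U p)"

lemma exterior_derivative_invariant:
  assumes "affine_connection M nab" "torsion_free M nab" "vector_field M U" "vector_field M V"
    and "p \<in> points M"
    and lin: "\<And>u v a b. u \<in> tangent_space M p \<Longrightarrow> v \<in> tangent_space M p \<Longrightarrow>
      \<omega> p (\<lambda>f. a * u f + b * v f) = a * \<omega> p u + b * \<omega> p v"
  shows "exterior_derivative nab \<omega> U V p =
    U p (\<lambda>q. \<omega> q (V q)) - V p (\<lambda>q. \<omega> q (U q)) - \<omega> p (lie_bracket U V p)"
proof -
  have "\<forall>X Y. vector_field M X \<longrightarrow> vector_field M Y \<longrightarrow> vector_field M (nab X Y)"
    using assms(1) unfolding affine_connection_def by (rule conjunct1)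
  then have "vector_field M (nab U V)" "vector_field M (nab V U)"
    using assms(3,4) by simp_all
  then have "nab U V p \<in> tangent_space M p" "nab V U p \<in> tangent_space M p"
    using assms(5) by (simp_all add: vector_field_def)
  moreover have "(\<lambda>p k. nab U V p k - nab V U p k) = lie_bracket U V"
    using assms(2-4) by (simp add: torsion_free_def)
  then have "lie_bracket U V p = (\<lambda>f. nab U V p f - nab V U p f)"
    by (metis (no_types))
  ultimately have "\<omega> p (lie_bracket U V p) = \<omega> p (nab U V p) - \<omega> p (nab V U p)"
    using lin[of "nab U V p" "nab V U p" 1 "-1"] by simp
  then show ?thesis
    by (simp add: exterior_derivative_def covariant_derivative_form_def)
qed

end

theory Submission
  imports Defs
begin

text \<open>Let \<open>T(X;Y,Z) = (\<nabla>\<^sub>X g\<^sub>t)(Y,Z)\<close>. Since \<open>\<nabla>\<^sup>t g\<^sub>t = 0\<close>, the difference tensor satisfies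
  \<open>T(X;Y,Z) = g\<^sub>t(D\<^sup>t(X,Y),Z) + g\<^sub>t(Y,D\<^sup>t(X,Z))\<close>, and \<open>D\<^sup>t\<close> is symmetric because both connections are
  torsion free. The alternating sum over permutations of the arguments that proves the Koszul
  formula therefore gives
  \<open>2 g\<^sub>t(D\<^sup>t(U,V),W) = T(U;V,W) + T(V;U,W) - T(W;U,V)\<close>
  (lemma \<open>difference_of_connections_koszul\<close>).

  On the other hand \<open>\<nabla>g = 0\<close>, so only the summand \<open>t \<omega>\<otimes>\<omega>\<close> of \<open>g\<^sub>t\<close> contributes to \<open>T\<close>:
  \<open>T(X;Y,Z) = t ((\<nabla>\<^sub>X\<omega>)(Y) \<omega>(Z) + \<omega>(Y) (\<nabla>\<^sub>X\<omega>)(Z))\<close>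
  (lemma \<open>covariant_derivative_canonical_variation\<close>). In the sum of the three terms, the factors of
  \<open>\<omega>(U)\<close> and \<open>\<omega>(V)\<close> are antisymmetrized derivatives of \<open>\<omega>\<close>, that is, values of \<open>d\<omega>\<close>. The factor of
  \<open>\<omega>(W)\<close> is the symmetrization \<open>(\<nabla>\<^sub>U\<omega>)(V) + (\<nabla>\<^sub>V\<omega>)(U)\<close>, which is \<open>(L\<^sub>E g)(U,V)\<close> because
  \<open>(\<nabla>\<^sub>X\<omega>)(Y) = g(\<nabla>\<^sub>X E, Y)\<close>
  (lemma \<open>lie_derivative_eq_symmetrized_covariant_derivative\<close>).

  A tangent vector is a derivation of smooth functions only, so to differentiate \<open>g\<^sub>t(Y,Z)\<close> term by
  term one must know that \<open>\<omega>(Y) \<omega>(Z)\<close> is smooth. This is why it matters that the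
  smooth functions are closed under products.\<close>

section \<open>The algebra of smooth functions\<close>

text \<open>Openness of \<open>S\<close> matters: the derivative at a point of \<open>S\<close> is a derivative in the full
  space, and only for an interior point is it determined by the values on \<open>S\<close>.\<close>

lemma Ck_on_cong:
  assumes "open S" "\<And>x. x \<in> S \<Longrightarrow> f x = h x" "Ck_on k S f"
  shows "Ck_on k S h"
  using assms(2,3)
proof (induction k arbitrary: f h)
  case 0
  then show ?case by (simp cong: continuous_on_cong)
next
  case (Suc k)
  have der: "(h has_derivative frechet_derivative f (at x)) (at x)" if "x \<in> S" for x
    using Suc.prems that assms(1)
    by (auto intro: has_derivative_transform_within_open simp: frechet_derivative_works)
  have "frechet_derivative h (at x) = frechet_derivative f (at x)" if "x \<in> S" for x
    using frechet_derivative_at[OF der[OF that]] by simp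
  then have "Ck_on k S (\<lambda>x. frechet_derivative h (at x) v)" for v
    using Suc.IH[of "\<lambda>x. frechet_derivative f (at x) v"] Suc.prems(2) by simp
  then show ?case
    using der by (auto simp: differentiable_def)
qed

lemma Ck_on_SucD: "Ck_on (Suc k) S f \<Longrightarrow> Ck_on k S f"
proof (induction k arbitrary: f)
  case 0
  then show ?case
    by (simp add: continuous_at_imp_continuous_on differentiable_imp_continuous_within)
next
  case (Suc k)
  then show ?case by (metis Ck_on.simps(2))
qed

lemma Ck_on_add:
  assumes "open S" "Ck_on k S f" "Ck_on k S h"
  shows "Ck_on k S (\<lambda>x. f x + h x)"
  using assms(2,3)
proof (induction k arbitrary: f h)
  case 0
  then show ?case by (simp add: continuous_on_add)
next
  case (Suc k)
  have "frechet_derivative f (at x) v + frechet_derivative h (at x) v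
      = frechet_derivative (\<lambda>x. f x + h x) (at x) v" if "x \<in> S" for x v
  proof -
    have "((\<lambda>x. f x + h x) has_derivative
        (\<lambda>v. frechet_derivative f (at x) v + frechet_derivative h (at x) v)) (at x)"
      using Suc.prems that by (auto intro!: has_derivative_add simp: frechet_derivative_works)
    from frechet_derivative_at[OF this] show ?thesis by metis
  qed
  moreover have "Ck_on k S (\<lambda>x. frechet_derivative f (at x) v + frechet_derivative h (at x) v)" for v
    using Suc.prems by (intro Suc.IH) simp_all
  ultimately have "Ck_on k S (\<lambda>x. frechet_derivative (\<lambda>x. f x + h x) (at x) v)" for v
    by (rule Ck_on_cong[OF assms(1)])
  then show ?case using Suc.prems by simp
qed

lemma Ck_on_mult:
  fixes f h :: "'b::real_normed_vector \<Rightarrow> real"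
  assumes "open S" "Ck_on k S f" "Ck_on k S h"
  shows "Ck_on k S (\<lambda>x. f x * h x)"
  using assms(2,3)
proof (induction k arbitrary: f h)
  case 0
  then show ?case by (simp add: continuous_on_mult)
next
  case (Suc k)
  have "f x * frechet_derivative h (at x) v + frechet_derivative f (at x) v * h x
      = frechet_derivative (\<lambda>x. f x * h x) (at x) v" if "x \<in> S" for x v
  proof -
    have "((\<lambda>x. f x * h x) has_derivative
        (\<lambda>v. f x * frechet_derivative h (at x) v + frechet_derivative f (at x) v * h x)) (at x)"
      using Suc.prems that by (auto intro!: has_derivative_mult simp: frechet_derivative_works)
    from frechet_derivative_at[OF this] show ?thesis by metis
  qed
  moreover have "Ck_on k S
      (\<lambda>x. f x * frechet_derivative h (at x) v + frechet_derivative f (at x) v * h x)" for v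
    using Suc.prems Suc.prems[THEN Ck_on_SucD] by (intro Ck_on_add[OF assms(1)] Suc.IH) simp_all
  ultimately have "Ck_on k S (\<lambda>x. frechet_derivative (\<lambda>x. f x * h x) (at x) v)" for v
    by (rule Ck_on_cong[OF assms(1)])
  then show ?case using Suc.prems by simp
qed

lemma Ck_on_const: "Ck_on k S (\<lambda>x. c)"
  by (induction k arbitrary: c) simp_all

lemma smooth_fun_const: "smooth_fun M (\<lambda>p. c)"
  by (auto simp: smooth_fun_def smooth_on_def comp_def Ck_on_const)

lemma smooth_fun_add:
  assumes "smooth_manifold M" "smooth_fun M f" "smooth_fun M h"
  shows "smooth_fun M (\<lambda>p. f p + h p)"
  unfolding smooth_fun_def smooth_on_def comp_def
proof safe
  fix U \<phi> k assume c: "(U, \<phi>) \<in> charts M"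
  have "open (\<phi> ` U)" using assms(1) c by (auto simp: smooth_manifold_def)
  then show "Ck_on k (\<phi> ` U) (\<lambda>x. f (inv_into U \<phi> x) + h (inv_into U \<phi> x))"
    using assms(2,3) c
    by (intro Ck_on_add) (auto simp: smooth_fun_def smooth_on_def comp_def)
qed

lemma smooth_fun_mult:
  assumes "smooth_manifold M" "smooth_fun M f" "smooth_fun M h"
  shows "smooth_fun M (\<lambda>p. f p * h p)"
  unfolding smooth_fun_def smooth_on_def comp_def
proof safe
  fix U \<phi> k assume c: "(U, \<phi>) \<in> charts M"
  have "open (\<phi> ` U)" using assms(1) c by (auto simp: smooth_manifold_def)
  then show "Ck_on k (\<phi> ` U) (\<lambda>x. f (inv_into U \<phi> x) * h (inv_into U \<phi> x))"
    using assms(2,3) c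
    by (intro Ck_on_mult) (auto simp: smooth_fun_def smooth_on_def comp_def)
qed


section \<open>Symmetric tensors and connections at a point\<close>

lemma vector_field_at: "vector_field M X \<Longrightarrow> p \<in> points M \<Longrightarrow> X p \<in> tangent_space M p"
  by (simp add: vector_field_def)

lemma affine_connection_field:
  "affine_connection M nab \<Longrightarrow> vector_field M X \<Longrightarrow> vector_field M Y \<Longrightarrow> vector_field M (nab X Y)"
  unfolding affine_connection_def by blast

lemma symmetric_tensor_commute:
  "\<lbrakk>symmetric_tensor M g; p \<in> points M; u \<in> tangent_space M p; v \<in> tangent_space M p\<rbrakk>
    \<Longrightarrow> g p u v = g p v u"
  by (simp add: symmetric_tensor_def)

lemma symmetric_tensor_linear:
  "\<lbrakk>symmetric_tensor M g; p \<in> points M; u \<in> tangent_space M p; v \<in> tangent_space M p;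
    w \<in> tangent_space M p\<rbrakk>
    \<Longrightarrow> g p (\<lambda>f. a * u f + b * v f) w = a * g p u w + b * g p v w"
  by (simp add: symmetric_tensor_def)

lemma symmetric_tensor_diff:
  "\<lbrakk>symmetric_tensor M g; p \<in> points M; u \<in> tangent_space M p; v \<in> tangent_space M p;
    w \<in> tangent_space M p\<rbrakk>
    \<Longrightarrow> g p (\<lambda>f. u f - v f) w = g p u w - g p v w"
  using symmetric_tensor_linear[of M g p u v w 1 "-1"] by simp

lemma tangent_space_linear:
  assumes "u \<in> tangent_space M p" "v \<in> tangent_space M p"
  shows "(\<lambda>f. a * u f + b * v f) \<in> tangent_space M p"
  using assms by (simp add: tangent_space_def algebra_simps)

lemma tangent_space_diff:
  "u \<in> tangent_space M p \<Longrightarrow> v \<in> tangent_space M p \<Longrightarrow> (\<lambda>f. u f - v f) \<in> tangent_space M p"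
  using tangent_space_linear[of u M p v 1 "-1"] by simp

lemma symmetric_tensor_smooth:
  "\<lbrakk>symmetric_tensor M g; vector_field M X; vector_field M Y\<rbrakk>
    \<Longrightarrow> smooth_fun M (\<lambda>p. g p (X p) (Y p))"
  by (simp add: symmetric_tensor_def)

lemma torsion_free_bracket:
  assumes "torsion_free M nab" "vector_field M X" "vector_field M Y"
  shows "lie_bracket X Y p = (\<lambda>f. nab X Y p f - nab Y X p f)"
proof -
  have "(\<lambda>p k. nab X Y p k - nab Y X p k) = lie_bracket X Y"
    using assms by (simp add: torsion_free_def)
  from fun_cong[OF this, of p] show ?thesis by (rule sym)
qed

lemma metric_compatibleD:
  "\<lbrakk>metric_compatible M g nab; vector_field M X; vector_field M Y; vector_field M Z; p \<in> points M\<rbrakk>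
    \<Longrightarrow> X p (\<lambda>q. g q (Y q) (Z q)) = g p (nab X Y p) (Z p) + g p (Y p) (nab X Z p)"
  by (simp add: metric_compatible_def)

lemma symmetric_tensor_canonical_variation:
  assumes "smooth_manifold M" "symmetric_tensor M g" "vector_field M E"
  shows "symmetric_tensor M (canonical_variation g E t)"
proof -
  have lin: "g p (E p) (\<lambda>f. a * u f + b * v f) = a * g p (E p) u + b * g p (E p) v"
    if "p \<in> points M" "u \<in> tangent_space M p" "v \<in> tangent_space M p" for p u v a b
  proof -
    note Ep = vector_field_at[OF assms(3) that(1)]
    note commute = symmetric_tensor_commute[OF assms(2) that(1) Ep]
    show ?thesis
      unfolding commute[OF tangent_space_linear[OF that(2,3)]] commute[OF that(2)] commute[OF that(3)]
      by (rule symmetric_tensor_linear[OF assms(2) that Ep])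
  qed
  have smooth: "smooth_fun M (\<lambda>p. g p (X p) (Y p) + t * (g p (E p) (X p) * g p (E p) (Y p)))"
    if "vector_field M X" "vector_field M Y" for X Y
    using assms(1,3) that
    by (intro smooth_fun_add smooth_fun_mult smooth_fun_const symmetric_tensor_smooth[OF assms(2)])
  show ?thesis
    unfolding symmetric_tensor_def canonical_variation_def dual_form_def
  proof (intro conjI ballI allI impI)
    fix p u v assume "p \<in> points M" "u \<in> tangent_space M p" "v \<in> tangent_space M p"
    then show "g p u v + t * (g p (E p) u * g p (E p) v) = g p v u + t * (g p (E p) v * g p (E p) u)"
      using symmetric_tensor_commute[OF assms(2)] by simp
  next
    fix p u v w a b
    assume "p \<in> points M" "u \<in> tangent_space M p" "v \<in> tangent_space M p" "w \<in> tangent_space M p"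
    then show "g p (\<lambda>f. a * u f + b * v f) w
        + t * (g p (E p) (\<lambda>f. a * u f + b * v f) * g p (E p) w)
      = a * (g p u w + t * (g p (E p) u * g p (E p) w))
        + b * (g p v w + t * (g p (E p) v * g p (E p) w))"
      using symmetric_tensor_linear[OF assms(2)] lin by (simp add: algebra_simps)
  qed (rule smooth)
qed


section \<open>Covariant derivatives of symmetric tensors\<close>

definition covariant_derivative_tensor ::
    "'a connection \<Rightarrow> ('a \<Rightarrow> 'a tangent) \<Rightarrow> 'a two_tensor \<Rightarrow> ('a \<Rightarrow> 'a tangent) \<Rightarrow> ('a \<Rightarrow> 'a tangent)
      \<Rightarrow> 'a \<Rightarrow> real" where
  "covariant_derivative_tensor nab X h Y Z =
     (\<lambda>p. X p (\<lambda>q. h q (Y q) (Z q)) - h p (nab X Y p) (Z p) - h p (Y p) (nab X Z p))"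

text \<open>The Koszul formula in a form relative to a second torsion free connection \<open>nab\<close> in place of
  the Lie bracket. As \<open>nab'\<close> preserves \<open>h\<close>, the covariant derivative of \<open>h\<close> along \<open>X\<close> is
  \<open>h(D(X,Y),Z) + h(Y,D(X,Z))\<close>; as \<open>D\<close> is symmetric, all terms but \<open>h(D(X,Y),Z)\<close> cancel.\<close>

lemma difference_of_connections_koszul:
  assumes h: "symmetric_tensor M h"
    and nab': "levi_civita M h nab'"
    and nab: "affine_connection M nab" "torsion_free M nab"
    and XYZ: "vector_field M X" "vector_field M Y" "vector_field M Z"
    and p: "p \<in> points M"
  shows "2 * h p (connection_difference nab' nab X Y p) (Z p) =
    covariant_derivative_tensor nab X h Y Z p + covariant_derivative_tensor nab Y h X Z p
    - covariant_derivative_tensor nab Z h X Y p"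
proof -
  let ?D = "connection_difference nab' nab"
  have nab'_parts: "affine_connection M nab'" "torsion_free M nab'" "metric_compatible M h nab'"
    using nab' by (simp_all add: levi_civita_def)
  have tangent: "nab A B p \<in> tangent_space M p" "nab' A B p \<in> tangent_space M p"
    if "vector_field M A" "vector_field M B" for A B
    using affine_connection_field[OF nab(1) that] affine_connection_field[OF nab'_parts(1) that]
    by (simp_all add: vector_field_at[OF _ p])
  have D_tangent: "?D A B p \<in> tangent_space M p" if "vector_field M A" "vector_field M B" for A B
    using tangent[OF that] by (simp add: connection_difference_def tangent_space_diff)
  have D_sym: "?D A B p = ?D B A p" if "vector_field M A" "vector_field M B" for A B
  proof
    fix f
    show "?D A B p f = ?D B A p f"
      using fun_cong[OF torsion_free_bracket[OF nab(2) that], of p f]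
        fun_cong[OF torsion_free_bracket[OF nab'_parts(2) that], of p f]
      by (simp add: connection_difference_def)
  qed
  have D_diff: "h p (?D A B p) (C p) = h p (nab' A B p) (C p) - h p (nab A B p) (C p)"
    if "vector_field M A" "vector_field M B" "vector_field M C" for A B C
    using that tangent
    by (simp add: connection_difference_def symmetric_tensor_diff[OF h p] vector_field_at[OF _ p])
  have deriv: "covariant_derivative_tensor nab A h B C p = h p (?D A B p) (C p) + h p (?D A C p) (B p)"
    if "vector_field M A" "vector_field M B" "vector_field M C" for A B C
    using that D_diff[of A B C] D_diff[of A C B]
      metric_compatibleD[OF nab'_parts(3) that p]
      symmetric_tensor_commute[OF h p tangent(1)[of A C] vector_field_at[OF _ p, of B]]
      symmetric_tensor_commute[OF h p tangent(2)[of A C] vector_field_at[OF _ p, of B]]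
    by (simp add: covariant_derivative_tensor_def)
  show ?thesis
    using XYZ by (simp add: deriv D_sym[of Y X] D_sym[of Z X] D_sym[of Z Y])
qed

text \<open>The factor \<open>g\<close> of the variation is parallel, and the rest is the Leibniz rule for \<open>\<omega>\<otimes>\<omega>\<close>.\<close>

lemma covariant_derivative_canonical_variation:
  fixes g :: "'a two_tensor" and E :: "'a \<Rightarrow> 'a tangent"
  defines "\<omega> \<equiv> dual_form g E"
  assumes M: "smooth_manifold M" and g: "symmetric_tensor M g"
    and nab: "metric_compatible M g nab"
    and E: "vector_field M E"
    and XYZ: "vector_field M X" "vector_field M Y" "vector_field M Z"
    and p: "p \<in> points M"
  shows "covariant_derivative_tensor nab X (canonical_variation g E t) Y Z p =
    t * (covariant_derivative_form nab X \<omega> Y p * \<omega> p (Z p)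
       + \<omega> p (Y p) * covariant_derivative_form nab X \<omega> Z p)"
proof -
  have smooth: "smooth_fun M (\<lambda>q. g q (Y q) (Z q))"
    "smooth_fun M (\<lambda>q. \<omega> q (Y q))" "smooth_fun M (\<lambda>q. \<omega> q (Z q))"
    using E XYZ by (simp_all add: \<omega>_def dual_form_def symmetric_tensor_smooth[OF g])
  have sum: "X p (\<lambda>q. a * f q + b * h q) = a * X p f + b * X p h"
    and prod: "X p (\<lambda>q. f q * h q) = f p * X p h + h p * X p f"
    if "smooth_fun M f" "smooth_fun M h" for f h a b
    using vector_field_at[OF XYZ(1) p] that by (simp_all add: tangent_space_def)
  have "X p (\<lambda>q. canonical_variation g E t q (Y q) (Z q)) =
      X p (\<lambda>q. g q (Y q) (Z q)) + t * X p (\<lambda>q. \<omega> q (Y q) * \<omega> q (Z q))"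
    using sum[OF smooth(1) smooth_fun_mult[OF M smooth(2,3)], of 1 t]
    by (simp add: canonical_variation_def \<omega>_def)
  then show ?thesis
    using metric_compatibleD[OF nab XYZ p] prod[OF smooth(2,3)]
    by (simp add: covariant_derivative_tensor_def covariant_derivative_form_def
        canonical_variation_def \<omega>_def[symmetric] algebra_simps)
qed

text \<open>For the Levi-Civita connection both sides are \<open>g(\<nabla>\<^sub>U E, V) + g(U, \<nabla>\<^sub>V E)\<close>: on the left the terms
  with \<open>\<nabla>\<^sub>E\<close> cancel against the derivative of \<open>g(U,V)\<close> along \<open>E\<close>, and on the right
  \<open>(\<nabla>\<^sub>X\<omega>)(Y) = X g(E,Y) - g(E,\<nabla>\<^sub>X Y)\<close>.\<close>

lemma lie_derivative_eq_symmetrized_covariant_derivative: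
  fixes g :: "'a two_tensor" and E :: "'a \<Rightarrow> 'a tangent"
  defines "\<omega> \<equiv> dual_form g E"
  assumes g: "symmetric_tensor M g" and nab: "levi_civita M g nab"
    and EUV: "vector_field M E" "vector_field M U" "vector_field M V"
    and p: "p \<in> points M"
  shows "lie_derivative E g U V p =
    covariant_derivative_form nab U \<omega> V p + covariant_derivative_form nab V \<omega> U p"
proof -
  have nab_parts: "affine_connection M nab" "torsion_free M nab" "metric_compatible M g nab"
    using nab by (simp_all add: levi_civita_def)
  have tangent: "nab A B p \<in> tangent_space M p"
    if "vector_field M A" "vector_field M B" for A B
    using affine_connection_field[OF nab_parts(1) that] by (rule vector_field_at[OF _ p])
  have form: "covariant_derivative_form nab A \<omega> B p = g p (nab A E p) (B p)"
    if "vector_field M A" "vector_field M B" for A B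
    using metric_compatibleD[OF nab_parts(3) that(1) EUV(1) that(2) p]
    by (simp add: covariant_derivative_form_def \<omega>_def dual_form_def)
  have bracket: "g p (lie_bracket E A p) (B p) = g p (nab E A p) (B p) - g p (nab A E p) (B p)"
    if "vector_field M A" "vector_field M B" for A B
    using that EUV tangent
    by (simp add: torsion_free_bracket[OF nab_parts(2)] symmetric_tensor_diff[OF g p]
        vector_field_at[OF _ p])
  have "lie_bracket E V p \<in> tangent_space M p"
    using EUV tangent by (simp add: torsion_free_bracket[OF nab_parts(2)] tangent_space_diff)
  then have "g p (U p) (lie_bracket E V p) = g p (lie_bracket E V p) (U p)"
    and "g p (U p) (nab E V p) = g p (nab E V p) (U p)"
    using symmetric_tensor_commute[OF g p vector_field_at[OF EUV(2) p]] tangent[OF EUV(1,3)]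
    by blast+
  then show ?thesis
    using EUV metric_compatibleD[OF nab_parts(3) EUV p]
    by (simp add: lie_derivative_def form bracket)
qed


section \<open>The difference of the Levi-Civita connections\<close>

theorem proposition2p3:
  fixes M :: "('a, 'b::euclidean_space) manifold"
    and g gt :: "'a two_tensor"
    and E U V W :: "'a \<Rightarrow> 'a tangent"
    and \<omega> :: "'a one_form"
    and \<epsilon> t :: real
    and nab nabt D :: "'a connection"
  assumes "smooth_manifold M"
    and "riemannian_metric M g \<or> (lorentzian_metric M g \<and> timelike_field M g E)"
    and "unitary_field M g E"
    and "\<forall>p\<in>points M. \<epsilon> = g p (E p) (E p)"
    and "\<omega> = dual_form g E"
    and "t \<noteq> - \<epsilon>"
    and "gt = canonical_variation g E t"
    and "levi_civita M g nab"
    and "levi_civita M gt nabt"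
    and "D = connection_difference nabt nab"
    and "vector_field M U" and "vector_field M V" and "vector_field M W"
  shows "\<forall>p\<in>points M.
    gt p (D U V p) (W p) = t / 2 *
      (\<omega> p (W p) * lie_derivative E g U V p
       + \<omega> p (U p) * exterior_derivative nab \<omega> V W p
       + \<omega> p (V p) * exterior_derivative nab \<omega> U W p)"
proof
  fix p assume p: "p \<in> points M"
  have g: "symmetric_tensor M g"
    using assms(2) by (auto simp: riemannian_metric_def lorentzian_metric_def)
  have E: "vector_field M E"
    using assms(3) by (simp add: unitary_field_def)
  have nab: "affine_connection M nab" "torsion_free M nab" "metric_compatible M g nab"
    using assms(8) by (simp_all add: levi_civita_def)
  have gt: "symmetric_tensor M gt"
    using symmetric_tensor_canonical_variation[OF assms(1) g E] by (simp add: assms(7))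
  have deriv: "covariant_derivative_tensor nab X gt Y Z p =
      t * (covariant_derivative_form nab X \<omega> Y p * \<omega> p (Z p)
         + \<omega> p (Y p) * covariant_derivative_form nab X \<omega> Z p)"
    if "vector_field M X" "vector_field M Y" "vector_field M Z" for X Y Z
    using covariant_derivative_canonical_variation[OF assms(1) g nab(3) E that p]
    by (simp add: assms(5,7))
  have "2 * gt p (D U V p) (W p) =
      covariant_derivative_tensor nab U gt V W p + covariant_derivative_tensor nab V gt U W p
      - covariant_derivative_tensor nab W gt U V p"
    unfolding assms(10)
    by (rule difference_of_connections_koszul[OF gt assms(9) nab(1,2) assms(11-13) p])
  moreover have "lie_derivative E g U V p =
      covariant_derivative_form nab U \<omega> V p + covariant_derivative_form nab V \<omega> U p"
    unfolding assms(5)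
    by (rule lie_derivative_eq_symmetrized_covariant_derivative[OF g assms(8) E assms(11,12) p])
  ultimately show "gt p (D U V p) (W p) = t / 2 *
      (\<omega> p (W p) * lie_derivative E g U V p
       + \<omega> p (U p) * exterior_derivative nab \<omega> V W p
       + \<omega> p (V p) * exterior_derivative nab \<omega> U W p)"
    using assms(11-13) by (simp add: deriv exterior_derivative_def algebra_simps)
qed

end
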